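(* Let $E$ be a Banach space, $\Lambda\subset E$ an open set, and $\mathcal F=\{M(x)\}_{x\in\Lambda}$ a family of linear subspaces of $E$ (possibly infinite dimensional). If $\mathcal F$ is $C^1$ integrable at $x_0\in\Lambda$, say with integral submanifold $S\subset E$ of $\mathcal F$ at $x_0$, then there exist a closed subspace $E_*$ of $E$ and a neighborhood $U_0$ of $x_0$ such that $$M(x)\oplus E_*=E\qquad\text{for all }x\in S\cap U_0,$$ i.e. $J(x_0,E_* )\supset S\cap U_0$.
   Context: $\oplus$ denotes a topological direct sum of closed subspaces. Integrability: $\mathcal F$ is $C^1$ integrable at $x_0$ with integral submanifold $S$ if there is a neighborhood of $x_0$ and a $C^1$ submanifold $S$ in it (with $S\subset\Lambda$) such that $x_0\in S$ and, for every $x\in S$, $M(x)=\{\dot c(0): c(t)\subset S \text{ a } C^1\text{-curve with } c(0)=x\}$. Here a $C^1$ submanifold $S$ of $E$ is a subset such that around each of its points there are an open neighborhood $W$ in $E$, a splitting $E=E_0\oplus E_1$, and a $C^1$ diffeomorphism $\varphi:W\to\varphi(W)$ onto an open subset of $E$ such that $\varphi(S\cap W)$ is an open subset of $E_0$. Co-final set: if $E=M(x_0)\oplus E_*$, then $J(x_0,E_* )=\{x\in\Lambda: M(x)\oplus E_*=E\}$. *)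

theory Defs
  imports "HOL-Analysis.Analysis"
begin

text \<open>
  \<open>E = A \<oplus> B\<close> as a topological direct sum of closed subspaces: addition \<open>A \<times> B \<rightarrow> E\<close> is a
  homeomorphism. Bijectivity is the algebraic part (\<open>A + B = E\<close>, \<open>A \<inter> B = {0}\<close>), and continuity of
  the inverse is the continuity of the two projections.
\<close>
definition topological_direct_sum :: "'a::real_normed_vector set \<Rightarrow> 'a set \<Rightarrow> bool" where
  "topological_direct_sum A B \<longleftrightarrow>
     subspace A \<and> closed A \<and> subspace B \<and> closed B \<and>
     (\<exists>g. homeomorphism (A \<times> B) UNIV (\<lambda>(a, b). a + b) g)"

text \<open>
  Continuity of the derivative is with respect to the operator norm, the topology of the type of
  bounded linear functions.
\<close>
definition C1_map_on :: "('a::real_normed_vector \<Rightarrow> 'b::real_normed_vector) \<Rightarrow> 'a set \<Rightarrow> bool" where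
  "C1_map_on f W \<longleftrightarrow>
     (\<exists>f' :: 'a \<Rightarrow> 'a \<Rightarrow>\<^sub>L 'b.
        (\<forall>x\<in>W. (f has_derivative blinfun_apply (f' x)) (at x)) \<and> continuous_on W f')"

definition C1_diffeomorphism_on ::
    "('a::real_normed_vector \<Rightarrow> 'b::real_normed_vector) \<Rightarrow> 'a set \<Rightarrow> bool" where
  "C1_diffeomorphism_on \<phi> W \<longleftrightarrow>
     open W \<and> open (\<phi> ` W) \<and> inj_on \<phi> W \<and>
     C1_map_on \<phi> W \<and> C1_map_on (inv_into W \<phi>) (\<phi> ` W)"

definition C1_submanifold :: "'a::real_normed_vector set \<Rightarrow> bool" where
  "C1_submanifold S \<longleftrightarrow>
     (\<forall>p\<in>S. \<exists>W E0 E1 \<phi>.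
        open W \<and> p \<in> W \<and> topological_direct_sum E0 E1 \<and>
        C1_diffeomorphism_on (\<phi> :: 'a \<Rightarrow> 'a) W \<and>
        openin (top_of_set E0) (\<phi> ` (S \<inter> W)))"

text \<open>
  A curve through \<open>x\<close> is defined on an open interval around \<open>0\<close>; only its values there matter.
\<close>
definition curve_velocities :: "'a::real_normed_vector set \<Rightarrow> 'a \<Rightarrow> 'a set" where
  "curve_velocities S x =
     {v. \<exists>c e. e > 0 \<and> c C1_differentiable_on {-e<..<e} \<and> c ` {-e<..<e} \<subseteq> S \<and>
               c 0 = x \<and> v = vector_derivative c (at 0)}"

definition C1_integrable_with ::
    "'a::real_normed_vector set \<Rightarrow> ('a \<Rightarrow> 'a set) \<Rightarrow> 'a \<Rightarrow> 'a set \<Rightarrow> bool" where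
  "C1_integrable_with \<Lambda> M x0 S \<longleftrightarrow>
     (\<exists>V. open V \<and> x0 \<in> V \<and> S \<subseteq> V) \<and> S \<subseteq> \<Lambda> \<and> C1_submanifold S \<and> x0 \<in> S \<and>
     (\<forall>x\<in>S. M x = curve_velocities S x)"

text \<open>
  The co-final set \<open>J(x0, E\<^sub>*)\<close>. The base point enters only through the standing condition
  \<open>E = M x0 \<oplus> E\<^sub>*\<close> under which it is considered, so it is not an argument here.
\<close>
definition cofinal_set ::
    "'a::real_normed_vector set \<Rightarrow> ('a \<Rightarrow> 'a set) \<Rightarrow> 'a set \<Rightarrow> 'a set" where
  "cofinal_set \<Lambda> M Es = {x \<in> \<Lambda>. topological_direct_sum (M x) Es}"

end

theory Submission
  imports Defs
begin

text \<open>
  In a chart \<open>\<phi>\<close> around \<open>x0\<close> with inverse \<open>\<psi>\<close> and splitting \<open>E = E0 \<oplus> E1\<close>, the tangent space at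
  \<open>x \<in> S\<close> is \<open>M x = D\<psi>(\<phi> x) E0\<close>. Take \<open>Es = D\<psi>(\<phi> x0) E1\<close>. If \<open>P\<close> is the projection onto \<open>E0\<close>
  along \<open>E1\<close>, then \<open>T x = D\<psi>(\<phi> x) P + D\<psi>(\<phi> x0) (1 - P)\<close> depends continuously on \<open>x\<close> and equals the
  isomorphism \<open>D\<psi>(\<phi> x0)\<close> at \<open>x = x0\<close>, so it is an isomorphism for \<open>x\<close> near \<open>x0\<close> by the Neumann
  argument. It carries \<open>E0 \<oplus> E1\<close> to \<open>M x \<oplus> Es\<close>.
\<close>

section \<open>Topological direct sums and bounded projections\<close>

lemma bounded_linear_if_continuous:
  fixes f :: "'a::real_normed_vector \<Rightarrow> 'b::real_normed_vector"
  assumes "linear f" and "continuous_on UNIV f"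
  shows "bounded_linear f"
proof -
  interpret linear f by fact
  have "isCont f 0"
    using assms(2) by (simp add: continuous_on_eq_continuous_at)
  then obtain d where d: "d > 0" "\<And>x. norm x < d \<Longrightarrow> norm (f x) < 1"
    unfolding continuous_at_eps_delta by (metis diff_zero dist_norm zero zero_less_one)
  have "norm (f x) \<le> norm x * (2 / d)" for x
  proof (cases "x = 0")
    case False
    \<comment> \<open>This scales \<open>x\<close> to norm \<open>d / 2\<close>, inside the ball on
      which \<open>norm (f _) < 1\<close>.\<close>
    define r where "r = d / (2 * norm x)"
    have r: "r > 0" using False d by (simp add: r_def)
    have "norm (r *\<^sub>R x) < d"
      using False d by (simp add: r_def)
    then have "r * norm (f x) < 1"
      using d(2)[of "r *\<^sub>R x"] r by (simp add: scale)
    then have "norm (f x) < 1 / r" using r by (simp add: field_simps)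
    then show ?thesis by (simp add: r_def field_simps)
  qed (simp add: zero)
  then show ?thesis
    by unfold_locales blast
qed

text \<open>Splittings become operators that can be composed, conjugated and estimated. The
  projection is the first component of the inverse of addition, and the continuity of that inverse
  makes it bounded; conversely \<open>x \<mapsto> (P x, x - P x)\<close> is a continuous inverse of
  addition.\<close>

lemma topological_direct_sum_iff_projection:
  "topological_direct_sum A B \<longleftrightarrow>
     (\<exists>P :: 'a::real_normed_vector \<Rightarrow>\<^sub>L 'a. (\<forall>x. P (P x) = P x) \<and> A = range P \<and> B = {x. P x = 0})"
proof
  assume AB: "topological_direct_sum A B"
  then obtain g where sA: "subspace A" and sB: "subspace B"
    and g: "homeomorphism (A \<times> B) UNIV (\<lambda>(a, b). a + b) g"
    unfolding topological_direct_sum_def by blast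
  have gA: "fst (g x) \<in> A" and gB: "snd (g x) \<in> B" for x
    using homeomorphism_image2[OF g] by (metis mem_Times_iff rangeI)+
  have gsum: "fst (g x) + snd (g x) = x" for x
    using homeomorphism_apply2[OF g, of x] by (simp add: case_prod_beta)
  have g_eq: "g (a + b) = (a, b)" if "a \<in> A" "b \<in> B" for a b
    using homeomorphism_apply1[OF g, of "(a, b)"] that by simp
  \<comment> \<open>Linearity comes from uniqueness of the decomposition: adding or scaling the
    components again gives components in \<open>A\<close> and \<open>B\<close>.\<close>
  have lin: "linear (fst \<circ> g)"
  proof (rule linearI)
    fix x y
    have "g (x + y) = g ((fst (g x) + fst (g y)) + (snd (g x) + snd (g y)))"
      using gsum by (metis (no_types, lifting) add.assoc add.left_commute)
    also have "\<dots> = (fst (g x) + fst (g y), snd (g x) + snd (g y))"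
      by (intro g_eq subspace_add sA sB gA gB)
    finally show "(fst \<circ> g) (x + y) = (fst \<circ> g) x + (fst \<circ> g) y" by simp
  next
    fix r x
    have "g (r *\<^sub>R x) = g (r *\<^sub>R fst (g x) + r *\<^sub>R snd (g x))"
      using gsum by (metis scaleR_right_distrib)
    also have "\<dots> = (r *\<^sub>R fst (g x), r *\<^sub>R snd (g x))"
      by (intro g_eq subspace_scale sA sB gA gB)
    finally show "(fst \<circ> g) (r *\<^sub>R x) = r *\<^sub>R (fst \<circ> g) x" by simp
  qed
  have "continuous_on UNIV (fst \<circ> g)"
    unfolding o_def by (intro continuous_on_fst homeomorphism_cont2[OF g])
  with lin have bl: "bounded_linear (fst \<circ> g)"
    by (rule bounded_linear_if_continuous)
  define P where "P = Blinfun (fst \<circ> g)"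
  have P: "P x = fst (g x)" for x
    using bounded_linear_Blinfun_apply[OF bl] by (simp add: P_def)
  have PA: "P a = a" if "a \<in> A" for a
    using g_eq[OF that subspace_0[OF sB]] by (simp add: P)
  have PB: "P b = 0" if "b \<in> B" for b
    using g_eq[OF subspace_0[OF sA] that] by (simp add: P)
  have "\<forall>x. P (P x) = P x" using PA gA by (simp add: P)
  moreover have "A = range P"
    using PA gA by (auto simp: P) (metis rangeI)
  moreover have "B = {x. P x = 0}"
    using PB gB gsum by (auto simp: P) (metis add_0)
  ultimately show "\<exists>P :: 'a \<Rightarrow>\<^sub>L 'a. (\<forall>x. P (P x) = P x) \<and> A = range P \<and> B = {x. P x = 0}"
    by blast
next
  assume "\<exists>P :: 'a \<Rightarrow>\<^sub>L 'a. (\<forall>x. P (P x) = P x) \<and> A = range P \<and> B = {x. P x = 0}"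
  then obtain P :: "'a \<Rightarrow>\<^sub>L 'a" where P: "\<And>x. P (P x) = P x"
    and A: "A = range P" and B: "B = {x. P x = 0}" by blast
  \<comment> \<open>As a set of fixed points, the range is the solution set of an equation between
    continuous maps, hence closed.\<close>
  have A': "A = {x. P x = x}" using P unfolding A by (auto simp: image_iff) metis
  have "subspace A" "subspace B"
    unfolding A' B
    by (auto simp: subspace_def blinfun.add_right blinfun.scaleR_right blinfun.zero_right)
  moreover have "closed A" "closed B"
    unfolding A' B by (intro closed_Collect_eq continuous_intros)+
  moreover have "homeomorphism (A \<times> B) UNIV (\<lambda>(a, b). a + b) (\<lambda>x. (P x, x - P x))"
  proof (rule homeomorphismI)
    show "continuous_on (A \<times> B) (\<lambda>(a, b). a + b)"
      unfolding case_prod_beta by (intro continuous_intros)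
    show "continuous_on UNIV (\<lambda>x. (P x, x - P x))"
      by (intro continuous_intros)
  qed (auto simp: A' B P blinfun.add_right blinfun.diff_right)
  ultimately show "topological_direct_sum A B"
    unfolding topological_direct_sum_def by blast
qed

text \<open>An isomorphism with bounded inverse transports a splitting: the projection
  \<open>P\<close> is conjugated to \<open>T P T'\<close>.\<close>

lemma topological_direct_sum_image:
  fixes T T' :: "'a::real_normed_vector \<Rightarrow>\<^sub>L 'a"
  assumes "topological_direct_sum A B"
    and TT': "\<And>x. T (T' x) = x" and T'T: "\<And>x. T' (T x) = x"
  shows "topological_direct_sum (T ` A) (T ` B)"
proof -
  from assms(1) obtain P :: "'a \<Rightarrow>\<^sub>L 'a" where P: "\<And>x. P (P x) = P x"
    and A: "A = range P" and B: "B = {x. P x = 0}"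
    unfolding topological_direct_sum_iff_projection by blast
  define Q where "Q = T o\<^sub>L P o\<^sub>L T'"
  have Q: "Q x = T (P (T' x))" for x by (simp add: Q_def)
  have "T ` A = range Q"
    unfolding A image_image Q using T'T by (auto simp: image_iff) metis
  moreover have "T ` B = {x. Q x = 0}"
    unfolding B using TT' T'T by (auto simp: Q image_iff blinfun.zero_right) (metis blinfun.zero_right)
  moreover have "Q (Q x) = Q x" for x by (simp add: Q P T'T)
  ultimately show ?thesis
    unfolding topological_direct_sum_iff_projection by blast
qed

section \<open>Inverting small perturbations of the identity\<close>

text \<open>Solving \<open>u - Q u = y\<close> means finding a fixed point of
  \<open>u \<mapsto> y + Q u\<close>, a contraction with constant \<open>norm Q\<close>;
  completeness enters here. Uniqueness of the fixed point makes the solution operator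
  linear.\<close>

lemma blinfun_id_minus_invertible:
  fixes Q :: "'a::banach \<Rightarrow>\<^sub>L 'a"
  assumes "norm Q < 1"
  obtains G :: "'a \<Rightarrow>\<^sub>L 'a" where "\<And>x. G (x - Q x) = x" "\<And>y. G y - Q (G y) = y"
proof -
  have ex1: "\<exists>!u. y + Q u = u" for y
  proof -
    have "dist (y + Q u) (y + Q v) \<le> norm Q * dist u v" for u v
      using norm_blinfun[of Q "u - v"] by (simp add: dist_norm blinfun.diff_right)
    with assms show ?thesis
      by (intro banach_fix_type[where c = "norm Q"]) auto
  qed
  then obtain g where "\<forall>y. y + Q (g y) = g y" by metis
  then have g: "g y - Q (g y) = y" for y by (metis add_diff_cancel_right')
  have g_unique: "g y = u" if "u - Q u = y" for u y
    using ex1[of y] g[of y] that by (metis diff_add_cancel)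
  have "bounded_linear g"
  proof (rule bounded_linear_intro)
    show "g (x + y) = g x + g y" for x y
      by (rule g_unique) (metis (no_types) g blinfun.add_right add_diff_add)
    show "g (r *\<^sub>R x) = r *\<^sub>R g x" for r x
      by (rule g_unique) (metis g blinfun.scaleR_right scaleR_right_diff_distrib)
    \<comment> \<open>The usual Neumann bound: \<open>norm y\<close> is at least
      \<open>norm (g y) - norm Q * norm (g y)\<close>.\<close>
    show "norm (g y) \<le> norm y * (1 / (1 - norm Q))" for y
    proof -
      have "norm (g y) - norm (Q (g y)) \<le> norm y"
        using norm_triangle_ineq2[of "g y" "Q (g y)"] by (simp add: g)
      with norm_blinfun[of Q "g y"] have "norm (g y) * (1 - norm Q) \<le> norm y"
        by (simp add: algebra_simps)
      with assms show ?thesis by (simp add: field_simps)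
    qed
  qed
  then have "blinfun_apply (Blinfun g) = g" by (rule bounded_linear_Blinfun_apply)
  then show thesis
    using that[of "Blinfun g"] g g_unique by simp
qed

section \<open>Tangent spaces in a chart\<close>

text \<open>Differentiating both composites of the chart and its inverse, which are the identity on
  open sets, shows that the derivatives \<open>A x\<close> and \<open>B (\<phi> x)\<close> invert
  each other. Continuity of \<open>B\<close> later makes the tangent spaces vary
  continuously.\<close>

lemma C1_diffeomorphism_onE:
  fixes \<phi> :: "'a::real_normed_vector \<Rightarrow> 'b::real_normed_vector"
  assumes "C1_diffeomorphism_on \<phi> W"
  obtains \<psi> and A :: "'a \<Rightarrow> 'a \<Rightarrow>\<^sub>L 'b" and B :: "'b \<Rightarrow> 'b \<Rightarrow>\<^sub>L 'a" where
    "\<And>x. x \<in> W \<Longrightarrow> \<psi> (\<phi> x) = x"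
    "\<And>x. x \<in> W \<Longrightarrow> (\<phi> has_derivative A x) (at x)"
    "\<And>y. y \<in> \<phi> ` W \<Longrightarrow> (\<psi> has_derivative B y) (at y)"
    "continuous_on (\<phi> ` W) B"
    "\<And>x v. x \<in> W \<Longrightarrow> B (\<phi> x) (A x v) = v"
    "\<And>x w. x \<in> W \<Longrightarrow> A x (B (\<phi> x) w) = w"
proof -
  define \<psi> where "\<psi> = inv_into W \<phi>"
  from assms have W: "open W" "open (\<phi> ` W)" and inj: "inj_on \<phi> W"
    and c: "C1_map_on \<phi> W" "C1_map_on \<psi> (\<phi> ` W)"
    unfolding C1_diffeomorphism_on_def \<psi>_def by auto
  have \<psi>\<phi>: "\<psi> (\<phi> x) = x" if "x \<in> W" for x
    using inj that by (simp add: \<psi>_def)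
  from c(1) obtain A :: "'a \<Rightarrow> 'a \<Rightarrow>\<^sub>L 'b"
    where A: "\<And>x. x \<in> W \<Longrightarrow> (\<phi> has_derivative A x) (at x)"
    unfolding C1_map_on_def by blast
  from c(2) obtain B :: "'b \<Rightarrow> 'b \<Rightarrow>\<^sub>L 'a"
    where B: "\<And>y. y \<in> \<phi> ` W \<Longrightarrow> (\<psi> has_derivative B y) (at y)" "continuous_on (\<phi> ` W) B"
    unfolding C1_map_on_def by blast
  have BA: "B (\<phi> x) (A x v) = v" if "x \<in> W" for x v
  proof -
    have "((\<lambda>x. \<psi> (\<phi> x)) has_derivative (\<lambda>v. B (\<phi> x) (A x v))) (at x)"
      by (rule has_derivative_compose[OF A[OF that] B(1)[OF imageI[OF that]]])
    moreover have "((\<lambda>x. \<psi> (\<phi> x)) has_derivative (\<lambda>v. v)) (at x)"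
      by (rule has_derivative_transform_within_open[OF has_derivative_ident W(1) that])
        (simp add: \<psi>\<phi>)
    ultimately show ?thesis by (metis has_derivative_unique)
  qed
  have AB: "A x (B (\<phi> x) w) = w" if "x \<in> W" for x w
  proof -
    have "(\<phi> has_derivative A x) (at (\<psi> (\<phi> x)))"
      using A \<psi>\<phi> that by simp
    then have "((\<lambda>y. \<phi> (\<psi> y)) has_derivative (\<lambda>w. A x (B (\<phi> x) w))) (at (\<phi> x))"
      by (rule has_derivative_compose[OF B(1)[OF imageI[OF that]]])
    moreover have "((\<lambda>y. \<phi> (\<psi> y)) has_derivative (\<lambda>w. w)) (at (\<phi> x))"
      by (rule has_derivative_transform_within_open[OF has_derivative_ident W(2)])
        (use that \<psi>\<phi> in auto)
    ultimately show ?thesis by (metis has_derivative_unique)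
  qed
  show thesis
    by (rule that[OF \<psi>\<phi> A B(1) B(2) BA AB])
qed

text \<open>Near time 0 the curve \<open>\<phi> (c t)\<close> lies in \<open>E0\<close>, so it is
  fixed by the projection \<open>P\<close>. Differentiating this identity at 0 shows that
  \<open>P\<close> fixes \<open>A v\<close>.\<close>

lemma curve_velocities_chart_subset:
  fixes \<phi> :: "'a::real_normed_vector \<Rightarrow> 'a" and A :: "'a \<Rightarrow>\<^sub>L 'a"
  assumes "topological_direct_sum E0 E1" and "open W" and "x \<in> W"
    and \<phi>: "(\<phi> has_derivative A) (at x)" and E0: "\<phi> ` (S \<inter> W) \<subseteq> E0"
    and v: "v \<in> curve_velocities S x"
  shows "A v \<in> E0"
proof -
  from assms(1) obtain P :: "'a \<Rightarrow>\<^sub>L 'a"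
    where P: "\<And>y. P (P y) = P y" and E0_range: "E0 = range P"
    unfolding topological_direct_sum_iff_projection by blast
  have E0_fix: "P y = y" if "y \<in> E0" for y using that P E0_range by auto
  from v obtain c e where e: "e > 0" and c: "c C1_differentiable_on {-e<..<e}"
    and cS: "c ` {-e<..<e} \<subseteq> S" and c0: "c 0 = x" and v_eq: "v = vector_derivative c (at 0)"
    unfolding curve_velocities_def by blast
  have cd: "(c has_vector_derivative v) (at 0)"
    using c e v_eq unfolding C1_differentiable_on_eq
    by (simp add: vector_derivative_works)
  have cont: "continuous_on {-e<..<e} c"
    by (intro C1_differentiable_imp_continuous_on c)
  \<comment> \<open>The curve may leave the chart domain, so only the times spent in
    \<open>W\<close> are kept; by continuity they form an open neighborhood of 0.\<close>
  define I where "I = c -` W \<inter> {-e<..<e}"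
  have I: "open I" "0 \<in> I"
    using continuous_open_preimage[OF cont _ \<open>open W\<close>] e c0 \<open>x \<in> W\<close>
    by (auto simp: I_def Int_commute)
  have d\<phi>: "((\<lambda>t. \<phi> (c t)) has_derivative (\<lambda>t. A (t *\<^sub>R v))) (at 0)"
    using \<phi> unfolding c0[symmetric]
    by (rule has_derivative_compose[OF cd[unfolded has_vector_derivative_def]])
  have "((\<lambda>t. P (\<phi> (c t))) has_derivative (\<lambda>t. P (A (t *\<^sub>R v)))) (at 0)"
    by (rule bounded_linear.has_derivative[OF blinfun.bounded_linear_right d\<phi>])
  moreover have "((\<lambda>t. P (\<phi> (c t))) has_derivative (\<lambda>t. A (t *\<^sub>R v))) (at 0)"
    by (rule has_derivative_transform_within_open[OF d\<phi> I])
      (use cS E0 in \<open>auto simp: I_def image_subset_iff intro!: E0_fix[symmetric]\<close>)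
  ultimately have "(\<lambda>t. P (A (t *\<^sub>R v))) = (\<lambda>t. A (t *\<^sub>R v))"
    by (rule has_derivative_unique)
  from fun_cong[OF this, of 1] have "P (A v) = A v" by simp
  then show ?thesis using E0_range by (metis rangeI)
qed

text \<open>The required curve is the image under \<open>\<psi>\<close> of the straight line
  \<open>y + t w\<close>. The line stays in the subspace \<open>E0\<close>, and relative openness of
  \<open>D\<close> keeps it in \<open>D\<close> for small \<open>t\<close>.\<close>

lemma curve_velocities_chart_supset:
  fixes \<psi> :: "'a::real_normed_vector \<Rightarrow> 'a" and B :: "'a \<Rightarrow> 'a \<Rightarrow>\<^sub>L 'a"
  assumes "subspace E0" and D: "openin (top_of_set E0) D" and "D \<subseteq> V" and \<psi>S: "\<psi> ` D \<subseteq> S"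
    and \<psi>: "\<And>y. y \<in> V \<Longrightarrow> (\<psi> has_derivative B y) (at y)" and B: "continuous_on V B"
    and y: "y \<in> D" and w: "w \<in> E0"
  shows "B y w \<in> curve_velocities S (\<psi> y)"
proof -
  from D obtain U where U: "open U" "D = E0 \<inter> U"
    unfolding openin_open by blast
  define l where "l t = y + t *\<^sub>R w" for t :: real
  have cont_l: "continuous_on X l" for X
    unfolding l_def by (intro continuous_intros)
  have "open (l -` U)"
    using \<open>open U\<close> cont_l[of UNIV]
    by (intro continuous_open_vimage) (simp_all add: continuous_on_eq_continuous_at)
  moreover have "0 \<in> l -` U" using y U by (simp add: l_def)
  ultimately obtain e where e: "e > 0" "ball 0 e \<subseteq> l -` U"
    using open_contains_ball by blast
  have lD: "l t \<in> D" if "t \<in> {-e<..<e}" for t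
  proof -
    have "l t \<in> U" using that e by (auto simp: subset_iff)
    moreover have "l t \<in> E0"
      using y w U \<open>subspace E0\<close> by (simp add: l_def subspace_add subspace_scale)
    ultimately show ?thesis using U by blast
  qed
  have der: "((\<lambda>t. \<psi> (l t)) has_vector_derivative B (l t) w) (at t)" if "t \<in> {-e<..<e}" for t
  proof -
    have "(l has_derivative (\<lambda>s. s *\<^sub>R w)) (at t)"
      unfolding l_def by (auto intro!: derivative_eq_intros)
    moreover have "(\<psi> has_derivative B (l t)) (at (l t))"
      using \<psi> lD[OF that] \<open>D \<subseteq> V\<close> by blast
    ultimately have "((\<lambda>t. \<psi> (l t)) has_derivative (\<lambda>s. B (l t) (s *\<^sub>R w))) (at t)"
      by (rule has_derivative_compose)
    then show ?thesis
      by (simp add: has_vector_derivative_def blinfun.scaleR_right)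
  qed
  \<comment> \<open>Operator norm continuity of \<open>B\<close> along the line makes the velocity
    continuous, so the curve is C1 and not merely differentiable.\<close>
  have "continuous_on {-e<..<e} (\<lambda>t. B (l t) w)"
    by (intro continuous_intros continuous_on_compose2[OF B cont_l])
      (use lD \<open>D \<subseteq> V\<close> in auto)
  then have "(\<lambda>t. \<psi> (l t)) C1_differentiable_on {-e<..<e}"
    unfolding C1_differentiable_on_def
    by (intro exI[of _ "\<lambda>t. B (l t) w"] conjI ballI) (rule der)
  moreover have "(\<lambda>t. \<psi> (l t)) ` {-e<..<e} \<subseteq> S"
    using lD \<psi>S by blast
  moreover have "B y w = vector_derivative (\<lambda>t. \<psi> (l t)) (at 0)"
    using vector_derivative_at[OF der[of 0]] e by (simp add: l_def)
  ultimately show ?thesis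
    unfolding curve_velocities_def using e(1)
    by (intro CollectI exI[of _ "\<lambda>t. \<psi> (l t)"] exI[of _ e]) (simp add: l_def)
qed

section \<open>A common complement for nearby tangent spaces\<close>

lemma topological_direct_sum_perturb:
  fixes A B C :: "'a::banach \<Rightarrow>\<^sub>L 'a" and P :: "'a \<Rightarrow>\<^sub>L 'a"
  assumes P: "\<And>x. P (P x) = P x"
    and AB: "\<And>x. A (B x) = x" and BA: "\<And>x. B (A x) = x"
    and small: "norm A * norm (C - B) * norm P < 1"
  shows "topological_direct_sum (C ` range P) (B ` {x. P x = 0})"
proof -
  \<comment> \<open>The sign is chosen so that \<open>A T = 1 - Q\<close> for the operator
    \<open>T\<close> defined below; the smallness hypothesis is exactly the submultiplicative bound
    on \<open>norm Q\<close>.\<close>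
  define Q where "Q = - (A o\<^sub>L (C - B) o\<^sub>L P)"
  have "norm Q \<le> norm (A o\<^sub>L (C - B)) * norm P"
    unfolding Q_def norm_minus_cancel by (rule norm_blinfun_compose)
  also have "\<dots> \<le> norm A * norm (C - B) * norm P"
    by (intro mult_right_mono norm_blinfun_compose norm_ge_zero)
  finally have "norm Q < 1" using small by linarith
  then obtain G :: "'a \<Rightarrow>\<^sub>L 'a" where G: "\<And>x. G (x - Q x) = x" "\<And>y. G y - Q (G y) = y"
    using blinfun_id_minus_invertible by blast
  define T where "T = B + ((C - B) o\<^sub>L P)"
  have T: "T x = B x + (C (P x) - B (P x))" for x
    by (simp add: T_def blinfun.add_left blinfun.diff_left)
  have AT: "A (T x) = x - Q x" for x
    by (simp add: T Q_def AB blinfun.add_right blinfun.minus_left blinfun.diff_left)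
  have "topological_direct_sum (range P) {x. P x = 0}"
    unfolding topological_direct_sum_iff_projection using P by blast
  then have "topological_direct_sum (T ` range P) (T ` {x. P x = 0})"
  proof (rule topological_direct_sum_image)
    show "(G o\<^sub>L A) (T x) = x" for x by (simp add: AT G)
    \<comment> \<open>Applying \<open>A\<close> to the left side gives
      \<open>G (A x) - Q (G (A x)) = A x\<close>; applying \<open>B\<close> then cancels
      \<open>A\<close>.\<close>
    show "T ((G o\<^sub>L A) x) = x" for x
      by (metis AT BA G(2) blinfun_compose.rep_eq comp_apply)
  qed
  \<comment> \<open>On the range of \<open>P\<close> the correction turns \<open>B\<close> into
    \<open>C\<close>; on the kernel it vanishes and \<open>T\<close> agrees with
    \<open>B\<close>.\<close>
  moreover have "T ` range P = C ` range P"
    by (simp add: image_image T P)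
  moreover have "T ` {x. P x = 0} = B ` {x. P x = 0}"
    by (intro image_cong) (simp_all add: T blinfun.zero_right)
  ultimately show ?thesis by simp
qed

theorem theorem2p1:
  fixes \<Lambda> :: "'a::banach set" and M :: "'a \<Rightarrow> 'a set" and x0 :: 'a and S :: "'a set"
  assumes "open \<Lambda>"
    and "\<And>x. x \<in> \<Lambda> \<Longrightarrow> subspace (M x)"
    and "x0 \<in> \<Lambda>"
    and "C1_integrable_with \<Lambda> M x0 S"
  shows "\<exists>Es U0. subspace Es \<and> closed Es \<and> open U0 \<and> x0 \<in> U0 \<and>
           (\<forall>x \<in> S \<inter> U0. topological_direct_sum (M x) Es) \<and>
           topological_direct_sum (M x0) Es \<and> S \<inter> U0 \<subseteq> cofinal_set \<Lambda> M Es"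
proof -
  from assms(4) have S: "S \<subseteq> \<Lambda>" "C1_submanifold S" "x0 \<in> S"
    and M: "\<And>x. x \<in> S \<Longrightarrow> M x = curve_velocities S x"
    unfolding C1_integrable_with_def by auto
  from S(2,3) obtain W E0 E1 and \<phi> :: "'a \<Rightarrow> 'a"
    where W: "open W" "x0 \<in> W" and E: "topological_direct_sum E0 E1"
      and diff: "C1_diffeomorphism_on \<phi> W"
      and op: "openin (top_of_set E0) (\<phi> ` (S \<inter> W))"
    unfolding C1_submanifold_def by blast
  from diff obtain \<psi> A B where
    \<psi>\<phi>: "\<And>x. x \<in> W \<Longrightarrow> \<psi> (\<phi> x) = x"
    and A: "\<And>x. x \<in> W \<Longrightarrow> (\<phi> has_derivative blinfun_apply (A x)) (at x)"
    and B: "\<And>y. y \<in> \<phi> ` W \<Longrightarrow> (\<psi> has_derivative blinfun_apply (B y)) (at y)"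
    and contB: "continuous_on (\<phi> ` W) B"
    and BA: "\<And>x v. x \<in> W \<Longrightarrow> B (\<phi> x) (A x v) = v"
    and AB: "\<And>x w. x \<in> W \<Longrightarrow> A x (B (\<phi> x) w) = w"
    by (rule C1_diffeomorphism_onE) blast
  from E obtain P :: "'a \<Rightarrow>\<^sub>L 'a" where P: "\<And>x. P (P x) = P x"
    and E0: "E0 = range P" and E1: "E1 = {x. P x = 0}"
    unfolding topological_direct_sum_iff_projection by blast
  \<comment> \<open>One inclusion writes a velocity \<open>v\<close> as
    \<open>B (\<phi> x) (A x v)\<close> with \<open>A x v\<close> in \<open>E0\<close>; the other
    uses lines in the chart through \<open>\<phi> x\<close>.\<close>
  have tangent: "M x = B (\<phi> x) ` E0" if "x \<in> S" "x \<in> W" for x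
  proof -
    have "A x v \<in> E0" if "v \<in> curve_velocities S x" for v
      using curve_velocities_chart_subset[OF E W(1) \<open>x \<in> W\<close> A[OF \<open>x \<in> W\<close>] _ that]
        openin_imp_subset[OF op] by blast
    then have "curve_velocities S x \<subseteq> B (\<phi> x) ` E0"
      using BA[OF \<open>x \<in> W\<close>] by (metis imageI subsetI)
    moreover have "B (\<phi> x) w \<in> curve_velocities S (\<psi> (\<phi> x))" if "w \<in> E0" for w
    proof (rule curve_velocities_chart_supset[OF _ op _ _ B contB _ that])
      show "subspace E0" using E by (simp add: topological_direct_sum_def)
    qed (use \<open>x \<in> S\<close> \<open>x \<in> W\<close> \<psi>\<phi> in auto)
    ultimately show ?thesis using M \<psi>\<phi> that by auto
  qed
  have "continuous_on W \<phi>"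
    using A by (meson continuous_at_imp_continuous_on has_derivative_continuous)
  then have "continuous_on W (\<lambda>x. norm (A x0) * norm (B (\<phi> x) - B (\<phi> x0)) * norm P)"
    by (intro continuous_intros continuous_on_compose2[OF contB]) auto
  \<comment> \<open>The neighborhood is cut out by the smallness condition of
    \<open>topological_direct_sum_perturb\<close>, with \<open>B (\<phi> x)\<close> as the
    perturbation of \<open>B (\<phi> x0)\<close>. The quantity is continuous on \<open>W\<close> and
    vanishes at \<open>x0\<close>.\<close>
  then have "open (W \<inter> (\<lambda>x. norm (A x0) * norm (B (\<phi> x) - B (\<phi> x0)) * norm P) -` {..<1})"
    (is "open ?U0")
    by (rule continuous_open_preimage) (simp_all add: W)
  moreover have "x0 \<in> ?U0" using W by simp
  moreover have sum: "topological_direct_sum (M x) (B (\<phi> x0) ` E1)" if "x \<in> S \<inter> ?U0" for x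
    using that topological_direct_sum_perturb[OF P AB BA, OF W(2) W(2), of "B (\<phi> x)"]
    by (simp add: tangent E0 E1)
  moreover have sum0: "topological_direct_sum (M x0) (B (\<phi> x0) ` E1)"
    using sum S W by simp
  moreover have "S \<inter> ?U0 \<subseteq> cofinal_set \<Lambda> M (B (\<phi> x0) ` E1)"
    using sum S(1) unfolding cofinal_set_def by blast
  moreover have "subspace (B (\<phi> x0) ` E1)" "closed (B (\<phi> x0) ` E1)"
    using sum0 by (simp_all add: topological_direct_sum_def)
  ultimately show ?thesis by blast
qed

end
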